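(* For every integer $n\ge 3$, $k(H(n,3)) \ge (n-3)3^{n-1}+6$.
   Context: The Hamming graph $H(n,3)$ has vertex set $\{1,2,3\}^n$, two vertices being adjacent iff they differ in exactly one coordinate. The competition graph $C(D)$ of a digraph $D$ is the simple graph on $V(D)$ in which distinct $u,v$ are adjacent iff some vertex $x$ satisfies $(u,x),(v,x)\in A(D)$. The competition number $k(G)$ of a graph $G$ is the least $k\ge0$ such that $G$ together with $k$ new isolated vertices is the competition graph of an acyclic digraph. *)

theory Defs
  imports "Graph_Theory.Graph_Theory" "HOL-Library.FuncSet"
begin

text \<open>
  Digraphs are records of type \<^typ>\<open>'a pair_pre_digraph\<close>. As in \<^theory>\<open>Graph_Theory.Pair_Digraph\<close>,
  a finite simple graph is a \<^const>\<open>pair_graph\<close>: a finite loop-free digraph with symmetric arc set,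
  each edge being represented by its two orientations.
\<close>

definition hamming_graph :: "nat \<Rightarrow> nat \<Rightarrow> (nat \<Rightarrow> nat) pair_pre_digraph" where
  "hamming_graph n q = (let V = {1..n} \<rightarrow>\<^sub>E {1..q} in
     \<lparr> pverts = V,
       parcs = {(x, y). x \<in> V \<and> y \<in> V \<and> (\<exists>!i. i \<in> {1..n} \<and> x i \<noteq> y i)} \<rparr>)"

definition competition_graph :: "'a pair_pre_digraph \<Rightarrow> 'a pair_pre_digraph" where
  "competition_graph D =
     \<lparr> pverts = pverts D,
       parcs = {(u, v). u \<in> pverts D \<and> v \<in> pverts D \<and> u \<noteq> v \<and>
                        (\<exists>x \<in> pverts D. (u, x) \<in> parcs D \<and> (v, x) \<in> parcs D)} \<rparr>"

definition add_isolated :: "'a pair_pre_digraph \<Rightarrow> nat \<Rightarrow> ('a + nat) pair_pre_digraph" where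
  "add_isolated G k =
     \<lparr> pverts = pverts G <+> {..<k},
       parcs = {(Inl u, Inl v) | u v. (u, v) \<in> parcs G} \<rparr>"

text \<open>The library notion of a cycle used here includes loops.\<close>

definition acyclic_digraph :: "'a pair_pre_digraph \<Rightarrow> bool" where
  "acyclic_digraph D \<longleftrightarrow> pair_fin_digraph D \<and> \<not> (\<exists>p. pre_digraph.cycle (with_proj D) p)"

definition competition_number :: "'a pair_pre_digraph \<Rightarrow> nat" where
  "competition_number G =
     (LEAST k. \<exists>D. acyclic_digraph D \<and> competition_graph D = add_isolated G k)"

lemma acyclic_digraph_iff:
  "acyclic_digraph D \<longleftrightarrow> pair_fin_digraph D \<and> acyclic (parcs D)"
proof (cases "pair_fin_digraph D")
  case True
  then interpret pair_fin_digraph D .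
  have "(\<exists>p. cycle p) \<longleftrightarrow> (\<exists>u. (u, u) \<in> (parcs D)\<^sup>+)"
  proof
    assume "\<exists>p. cycle p"
    then obtain u p where "awalk u p u" "p \<noteq> []"
      unfolding cycle_def by auto
    then show "\<exists>u. (u, u) \<in> (parcs D)\<^sup>+"
      using reachable1_awalk by blast
  next
    assume "\<exists>u. (u, u) \<in> (parcs D)\<^sup>+"
    then obtain u p where "awalk u p u" "p \<noteq> []"
      using reachable1_awalk by blast
    then have "closed_w p"
      unfolding closed_w_def by auto
    then show "\<exists>p. cycle p"
      by (rule closed_w_imp_cycle)
  qed
  then show ?thesis
    using True by (auto simp: acyclic_digraph_def acyclic_def)
qed (simp add: acyclic_digraph_def)

lemma pair_graph_hamming_graph: "pair_graph (hamming_graph n q)"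
proof -
  let ?V = "{1..n} \<rightarrow>\<^sub>E {1..q}"
  have fin: "finite ?V"
    by (simp add: finite_PiE)
  have "parcs (hamming_graph n q) \<subseteq> ?V \<times> ?V"
    by (auto simp: hamming_graph_def Let_def)
  then have "finite (parcs (hamming_graph n q))"
    using fin by (meson finite_SigmaI finite_subset)
  moreover have "sym (parcs (hamming_graph n q))"
  proof (rule symI)
    fix x y assume "(x, y) \<in> parcs (hamming_graph n q)"
    then have V: "x \<in> ?V" "y \<in> ?V" and "\<exists>!i. i \<in> {1..n} \<and> x i \<noteq> y i"
      unfolding hamming_graph_def Let_def by simp_all
    then have "\<exists>!i. i \<in> {1..n} \<and> y i \<noteq> x i"
      by metis
    with V show "(y, x) \<in> parcs (hamming_graph n q)"
      unfolding hamming_graph_def Let_def by simp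
  qed
  moreover have "fst e \<in> pverts (hamming_graph n q) \<and> snd e \<in> pverts (hamming_graph n q) \<and> fst e \<noteq> snd e"
    if "e \<in> parcs (hamming_graph n q)" for e
    using that unfolding hamming_graph_def Let_def by (cases e) (simp, metis)
  moreover have "finite (pverts (hamming_graph n q))"
    using fin by (simp add: hamming_graph_def Let_def)
  ultimately show ?thesis
    by unfold_locales (simp_all add: symmetric_def)
qed

text \<open>
  The least number in \<^const>\<open>competition_number\<close> exists for every finite simple graph: add one new
  vertex for each arc of the graph, as the common prey of the two ends of that arc.
\<close>

lemma competition_number_exists:
  assumes "pair_graph G"
  shows "\<exists>k D. acyclic_digraph D \<and> competition_graph D = add_isolated G k"
proof -
  interpret pair_graph G by (rule assms)
  define k where "k = card (parcs G)"
  have "finite (parcs G)" by (rule pair_finite_arcs)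
  then obtain b where b: "bij_betw b (parcs G) {..<k}"
    unfolding k_def using ex_bij_betw_finite_nat lessThan_atLeast0 by metis
  define A :: "('a + nat) rel" where "A = (\<lambda>e. (Inl (fst e), Inr (b e))) ` parcs G
                    \<union> (\<lambda>e. (Inl (snd e), Inr (b e))) ` parcs G"
  define D where "D = \<lparr> pverts = pverts G <+> {..<k}, parcs = A \<rparr>"
  have b_less: "b e < k" if "e \<in> parcs G" for e
    using b that by (auto simp: bij_betw_def)
  have b_inj: "e = e'" if "b e = b e'" "e \<in> parcs G" "e' \<in> parcs G" for e e'
    using b that by (auto simp: bij_betw_def inj_on_def)
  have sym: "(v, u) \<in> parcs G" if "(u, v) \<in> parcs G" for u v
    using pair_sym_arcs that by (auto simp: symmetric_def sym_def)
  have "pair_fin_digraph D"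
    using pair_finite_verts pair_finite_arcs
    by unfold_locales
      (auto simp: D_def A_def b_less dest: in_arcsD1 in_arcsD2)
  moreover have "acyclic (parcs D)"
    by (rule acyclicI_order[where f = "case_sum (\<lambda>_. 1 :: nat) (\<lambda>_. 0)"])
      (auto simp: D_def A_def)
  moreover have "parcs (competition_graph D) = parcs (add_isolated G k)"
  proof (intro equalityI subsetI)
    fix z assume "z \<in> parcs (competition_graph D)"
    then obtain u v x where z: "z = (u, v)" "u \<noteq> v" "(u, x) \<in> A" "(v, x) \<in> A"
      by (auto simp: competition_graph_def D_def)
    have prey: "\<exists>e \<in> parcs G. x = Inr (b e) \<and> (w = Inl (fst e) \<or> w = Inl (snd e))"
      if "(w, x) \<in> A" for w
      using that unfolding A_def by blast
    obtain e where e: "e \<in> parcs G" "x = Inr (b e)" "u = Inl (fst e) \<or> u = Inl (snd e)"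
      using prey z(3) by blast
    obtain e' where e': "e' \<in> parcs G" "x = Inr (b e')" "v = Inl (fst e') \<or> v = Inl (snd e')"
      using prey z(4) by blast
    from e e' have "e' = e" using b_inj by auto
    then show "z \<in> parcs (add_isolated G k)"
      using z e e' sym by (cases e) (auto simp: add_isolated_def)
  next
    fix z assume "z \<in> parcs (add_isolated G k)"
    then obtain u v where z: "z = (Inl u, Inl v)" "(u, v) \<in> parcs G"
      by (auto simp: add_isolated_def)
    moreover have "(Inl u, Inr (b (u, v))) \<in> A" "(Inl v, Inr (b (u, v))) \<in> A"
      using z by (force simp: A_def)+
    moreover have "u \<noteq> v"
      using pair_no_loops z by fastforce
    ultimately show "z \<in> parcs (competition_graph D)"
      using b_less in_arcsD1 in_arcsD2
      by (auto simp: competition_graph_def D_def)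
  qed
  then have "competition_graph D = add_isolated G k"
    by (simp add: competition_graph_def add_isolated_def D_def)
  ultimately show ?thesis
    using acyclic_digraph_iff by blast
qed

end

theory Submission
  imports Defs
begin

text \<open>
  Every clique of the Hamming graph with at least two points lies on a single line, so the prey
  realising edges of different lines are different. Hence an acyclic digraph \<open>D\<close> realising the
  graph has at least as many vertices as there are lines, namely \<open>n 3\<^sup>n\<^sup>-\<^sup>1\<close>. Six further vertices
  come from the start of a topological order of \<open>D\<close>: choose for each line a prey that is as late as
  possible. A prey among the first thirteen vertices is then chosen only for a line whose three
  points are among the first twelve, and twelve points contain at most seven lines.
\<close>

section \<open>Lines of the ternary cube and their number\<close>

text \<open>A line is encoded by its direction \<open>i\<close> and its point with \<open>i\<close>-th coordinate 1.\<close>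

definition lines_in :: "nat \<Rightarrow> (nat \<Rightarrow> nat) set \<Rightarrow> (nat \<times> (nat \<Rightarrow> nat)) set" where
  "lines_in n S = {(i, x). i \<in> {1..n} \<and> x i = 1 \<and> (\<forall>a\<in>{1..3}. x(i := a) \<in> S)}"

lemma lines_in_subset: "lines_in n S \<subseteq> {1..n} \<times> S"
proof clarify
  fix i x assume "(i, x) \<in> lines_in n S"
  then have "i \<in> {1..n}" "x i = 1" "x(i := 1) \<in> S"
    by (auto simp: lines_in_def)
  moreover from this have "x(i := 1) = x" by (metis fun_upd_triv)
  ultimately show "i \<in> {1..n} \<and> x \<in> S" by simp
qed

lemma finite_lines_in: "finite S \<Longrightarrow> finite (lines_in n S)"
  using lines_in_subset finite_subset by (metis finite_SigmaI finite_atLeastAtMost)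

text \<open>For each of the \<open>n\<close> directions the base point has its entry in that
  direction fixed to 1, while the other \<open>n - 1\<close> entries range freely over three
  values.\<close>

lemma card_lines_in_cube:
  "card (lines_in n ({1..n} \<rightarrow>\<^sub>E {1..3})) = n * 3 ^ (n - 1)"
proof -
  let ?V = "{1..n} \<rightarrow>\<^sub>E {1..3::nat}"
  let ?B = "\<lambda>i. \<Pi>\<^sub>E j\<in>{1..n}. if j = i then {1} else {1..3::nat}"
  have "lines_in n ?V = (SIGMA i:{1..n}. ?B i)"
  proof (intro equalityI subrelI)
    fix i x assume l: "(i, x) \<in> lines_in n ?V"
    then have "x \<in> ?V" "i \<in> {1..n}" "x i = 1"
      using lines_in_subset by (auto simp: lines_in_def)
    then show "(i, x) \<in> (SIGMA i:{1..n}. ?B i)"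
      by (auto simp: PiE_iff)
  next
    fix i x assume "(i, x) \<in> (SIGMA i:{1..n}. ?B i)"
    then have i: "i \<in> {1..n}" and x: "x \<in> ?B i" by auto
    have "x i = 1" using PiE_mem[OF x i] by simp
    moreover have "x(i := a) \<in> ?V" if "a \<in> {1..3}" for a
      using x i that by (auto simp: PiE_iff extensional_def split: if_splits)
    ultimately show "(i, x) \<in> lines_in n ?V"
      using i by (simp add: lines_in_def)
  qed
  moreover have "card (?B i) = 3 ^ (n - 1)" if "i \<in> {1..n}" for i
  proof -
    have "card (?B i) = (\<Prod>j\<in>{1..n}. if j = i then 1 else 3)"
      by (subst card_PiE) (auto intro!: prod.cong)
    also have "\<dots> = (\<Prod>j\<in>{1..n} - {i}. 3)"
      using that by (subst prod.remove[of _ i]) (auto intro!: prod.cong)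
    finally show ?thesis using that by simp
  qed
  ultimately show ?thesis
    by (simp add: finite_PiE)
qed

section \<open>The number of lines in at most twelve points\<close>

text \<open>\<open>line_bound ! m\<close> is the largest possible number of lines in a set of \<open>m\<close> points.\<close>

definition line_bound :: "nat list" where
  "line_bound = [0, 0, 0, 1, 1, 2, 2, 3, 4, 6, 6, 7, 7]"

text \<open>This is the induction step for the bound on lines. Splitting a set by the value of one
  coordinate gives layers of \<open>a\<close>, \<open>b\<close>, \<open>c\<close> points; a line
  lies inside one layer or crosses all three, and at most \<open>min a (min b c)\<close> lines
  cross. Only finitely many triples occur, so evaluation decides the claim.\<close>

lemma line_bound_split:
  assumes "a + b + c \<le> 12" "a < a + b + c" "b < a + b + c" "c < a + b + c"
  shows "line_bound ! a + line_bound ! b + line_bound ! c + min a (min b c)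
           \<le> line_bound ! (a + b + c)"
proof -
  have "\<forall>a\<in>set [0..<13]. \<forall>b\<in>set [0..<13 - a]. \<forall>c\<in>set [0..<13 - a - b].
      a < a + b + c \<longrightarrow> b < a + b + c \<longrightarrow> c < a + b + c \<longrightarrow>
      line_bound ! a + line_bound ! b + line_bound ! c + min a (min b c)
        \<le> line_bound ! (a + b + c)"
    by code_simp
  moreover have "a \<in> set [0..<13]" "b \<in> set [0..<13 - a]" "c \<in> set [0..<13 - a - b]"
    using assms(1) by auto
  ultimately show ?thesis using assms(2-4) by blast
qed

lemma line_bound_le: "m \<le> 12 \<Longrightarrow> line_bound ! m \<le> 7"
proof -
  have "\<forall>m\<in>set [0..<13]. line_bound ! m \<le> 7" by code_simp
  moreover assume "m \<le> 12"
  then have "m \<in> set [0..<13]" by auto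
  ultimately show ?thesis by blast
qed

text \<open>A line in direction \<open>i\<close> meets the layer \<open>x i = a\<close> in one
  point, and this point together with \<open>i\<close> determines the line.\<close>

lemma card_direction_lines_le:
  assumes "finite S" "a \<in> {1..3}"
  shows "card {l \<in> lines_in n S. fst l = i} \<le> card {x \<in> S. x i = a}"
proof (rule card_inj_on_le)
  let ?f = "\<lambda>l::nat \<times> (nat \<Rightarrow> nat). (snd l)(i := a)"
  show "inj_on ?f {l \<in> lines_in n S. fst l = i}"
  proof (rule inj_onI, clarsimp simp: lines_in_def)
    fix x y :: "nat \<Rightarrow> nat"
    assume "x i = Suc 0" "y i = Suc 0" "x(i := a) = y(i := a)"
    then show "x = y" by (metis fun_upd_triv fun_upd_upd)
  qed
  show "?f ` {l \<in> lines_in n S. fst l = i} \<subseteq> {x \<in> S. x i = a}"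
    using assms(2) by (auto simp: lines_in_def)
qed (use assms in simp)

text \<open>Induction on the size of \<open>S\<close>: slice \<open>S\<close> along a coordinate
  that is not constant on it, so that all three layers are smaller, and count the lines inside
  layers and those across them separately.\<close>

lemma card_lines_in_le_line_bound:
  assumes "S \<subseteq> {1..n} \<rightarrow>\<^sub>E {1..3}" "card S \<le> 12"
  shows "card (lines_in n S) \<le> line_bound ! card S"
  using assms
proof (induction "card S" arbitrary: S rule: less_induct)
  case less
  have fin: "finite S"
    using less.prems(1) finite_PiE[of "{1..n}" "\<lambda>_. {1..3::nat}"] finite_subset by blast
  show ?case
  proof (cases "\<exists>x\<in>S. \<exists>y\<in>S. x \<noteq> y")
    case False
    have "lines_in n S = {}"
    proof (rule equals0I, clarify)
      fix i x assume "(i, x) \<in> lines_in n S"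
      then have "x(i := 1) \<in> S" "x(i := 2) \<in> S" by (auto simp: lines_in_def)
      then have "x(i := 1) = x(i := 2)" using False by blast
      from fun_cong[OF this, of i] show False by simp
    qed
    then show ?thesis by simp
  next
    case True
    then obtain x y where xy: "x \<in> S" "y \<in> S" "x \<noteq> y" by blast
    \<comment> \<open>Extensionality places a coordinate where \<open>x\<close> and \<open>y\<close>
      differ inside \<open>{1..n}\<close>.\<close>
    moreover have "x \<in> extensional {1..n}" "y \<in> extensional {1..n}"
      using xy less.prems(1) by (auto simp: PiE_iff)
    ultimately obtain i where i: "i \<in> {1..n}" "x i \<noteq> y i"
      by (meson extensionalityI)
    define T where "T a = {z \<in> S. z i = a}" for a
    have fT: "finite (T a)" for a using fin by (simp add: T_def)
    have range: "z i \<in> {1, 2, 3}" if "z \<in> S" for z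
    proof -
      have "z i \<in> {1..3}" using that i less.prems(1) by (auto simp: PiE_iff)
      then show ?thesis by auto
    qed
    then have S: "S = T 1 \<union> T 2 \<union> T 3" by (fastforce simp: T_def)
    have "card S = card (T 1 \<union> T 2) + card (T 3)"
      by (subst S, rule card_Un_disjoint) (use fT in \<open>auto simp: T_def\<close>)
    moreover have "card (T 1 \<union> T 2) = card (T 1) + card (T 2)"
      by (rule card_Un_disjoint) (use fT in \<open>auto simp: T_def\<close>)
    ultimately have cS: "card S = card (T 1) + card (T 2) + card (T 3)"
      by simp
    have lt: "card (T a) < card S" for a
    proof (rule psubset_card_mono[OF fin])
      have "x \<notin> T a \<or> y \<notin> T a" using i by (auto simp: T_def)
      moreover have "T a \<subseteq> S" by (auto simp: T_def)
      ultimately show "T a \<subset> S" using xy by blast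
    qed
    have IH: "card (lines_in n (T a)) \<le> line_bound ! card (T a)" for a
    proof (rule less.hyps[OF lt])
      show "T a \<subseteq> {1..n} \<rightarrow>\<^sub>E {1..3}" using less.prems(1) by (auto simp: T_def)
      show "card (T a) \<le> 12" using lt[of a] less.prems(2) by simp
    qed
    define P where "P = {l \<in> lines_in n S. fst l = i}"
    have "lines_in n S \<subseteq> P \<union> lines_in n (T 1) \<union> lines_in n (T 2) \<union> lines_in n (T 3)"
    proof clarify
      fix j z
      assume l: "(j, z) \<in> lines_in n S" and not: "(j, z) \<notin> lines_in n (T 3)"
        "(j, z) \<notin> lines_in n (T 2)" "(j, z) \<notin> lines_in n (T 1)"
      have "z \<in> S" using l lines_in_subset by blast
      then have "z i \<in> {1, 2, 3}" by (rule range)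
      then have "(j, z) \<notin> lines_in n (T (z i))" using not by auto
      \<comment> \<open>Along a line in another direction the \<open>i\<close>-th coordinate is
        constant, so the whole line stays in one layer.\<close>
      moreover have "(j, z) \<in> lines_in n (T (z i))" if "j \<noteq> i"
        using l that by (auto simp: lines_in_def T_def)
      ultimately show "(j, z) \<in> P" using l by (auto simp: P_def)
    qed
    then have "card (lines_in n S)
        \<le> card (P \<union> lines_in n (T 1) \<union> lines_in n (T 2) \<union> lines_in n (T 3))"
      by (rule card_mono[rotated]) (use fin fT in \<open>simp add: finite_lines_in P_def\<close>)
    also have "\<dots> \<le> card P + card (lines_in n (T 1)) + card (lines_in n (T 2))
        + card (lines_in n (T 3))"
      by (meson add_le_mono1 card_Un_le order_trans)
    also have "\<dots> \<le> line_bound ! card (T 1) + line_bound ! card (T 2) + line_bound ! card (T 3)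
        + min (card (T 1)) (min (card (T 2)) (card (T 3)))"
    proof -
      have "card P \<le> card (T a)" if "a \<in> {1..3}" for a
        unfolding P_def T_def by (rule card_direction_lines_le[OF fin that])
      then have "card P \<le> min (card (T 1)) (min (card (T 2)) (card (T 3)))"
        by simp
      then show ?thesis using IH[of 1] IH[of 2] IH[of 3] by linarith
    qed
    also have "\<dots> \<le> line_bound ! card S"
      unfolding cS by (rule line_bound_split) (use lt[of 1] lt[of 2] lt[of 3] less.prems(2) cS in linarith)+
    finally show ?thesis .
  qed
qed

section \<open>Cliques of the Hamming graph\<close>

text \<open>The points \<open>u\<close> and \<open>v\<close> differ at \<open>i\<close> only. If
  \<open>w\<close> differed from \<open>u\<close> at \<open>j\<close>, it would agree with
  \<open>u\<close> at \<open>i\<close> and hence differ from \<open>v\<close> at both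
  \<open>i\<close> and \<open>j\<close>. Thus a clique containing an edge lies on the line of that
  edge.\<close>

lemma hamming_clique_direction:
  assumes "(u, v) \<in> parcs (hamming_graph n q)"
    and "w = u \<or> (u, w) \<in> parcs (hamming_graph n q)"
    and "w = v \<or> (v, w) \<in> parcs (hamming_graph n q)"
    and "u i \<noteq> v i" "j \<noteq> i"
  shows "w j = u j"
proof (rule ccontr)
  let ?V = "{1..n} \<rightarrow>\<^sub>E {1..q}"
  have arc: "x \<in> ?V \<and> y \<in> ?V \<and> (\<exists>!k. k \<in> {1..n} \<and> x k \<noteq> y k)"
    if "(x, y) \<in> parcs (hamming_graph n q)" for x y
    using that unfolding hamming_graph_def Let_def by simp
  have V: "u \<in> ?V" "v \<in> ?V" "w \<in> ?V"
    using arc[OF assms(1)] assms(2) arc[of u w] by blast+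
  \<comment> \<open>Outside \<open>{1..n}\<close> all vertices take the same default value.\<close>
  have dom: "k \<in> {1..n}" if "x \<in> ?V" "y \<in> ?V" "x k \<noteq> y k" for x y k
    using that PiE_arb[of x _ _ k] PiE_arb[of y _ _ k] by metis
  have uniq: "k = l"
    if "(x, y) \<in> parcs (hamming_graph n q)" "k \<in> {1..n}" "l \<in> {1..n}" "x k \<noteq> y k" "x l \<noteq> y l"
    for x y k l
    using arc[OF that(1)] that(2-5) by blast
  assume wj: "w j \<noteq> u j"
  have i: "i \<in> {1..n}" and j: "j \<in> {1..n}"
    using dom V assms(4) wj by blast+
  have "v j = u j" using uniq[OF assms(1) i j] assms(4,5) by metis
  moreover have "w i = u i" using uniq[of u w i j] assms(2,5) wj i j by metis
  ultimately show False using uniq[of v w i j] assms(3-5) wj i j by metis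
qed

section \<open>Initial segments of a finite acyclic relation\<close>

text \<open>A finite acyclic relation is well-founded, so a minimal element of the remaining
  vertices can be added repeatedly. The vertex \<open>w\<close> is the next one in this order: its
  predecessors too lie in \<open>S\<close>, so \<open>m + 1\<close> vertices have all their
  predecessors among the first \<open>m\<close>.\<close>

lemma ex_initial_segment:
  assumes "finite A" "r \<subseteq> A \<times> A" "acyclic r" "m < card A"
  obtains S w where "S \<subseteq> A" "card S = m" "w \<in> A - S"
    "\<And>u v. (u, v) \<in> r \<Longrightarrow> v \<in> insert w S \<Longrightarrow> u \<in> S"
proof -
  have "wf r"
    using assms finite_acyclic_wf finite_subset by (metis finite_SigmaI)
  have next_vertex: "\<exists>w\<in>A - S. \<forall>u. (u, w) \<in> r \<longrightarrow> u \<in> S" if "S \<subseteq> A" "card S < card A" for S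
  proof -
    have "A - S \<noteq> {}" using that by auto
    then obtain w where "w \<in> A - S" "\<And>u. (u, w) \<in> r \<Longrightarrow> u \<notin> A - S"
      using \<open>wf r\<close> by (metis wfE_min ex_in_conv)
    then show ?thesis using assms(2) by blast
  qed
  have "\<exists>S\<subseteq>A. card S = m \<and> (\<forall>u v. (u, v) \<in> r \<longrightarrow> v \<in> S \<longrightarrow> u \<in> S)"
    using assms(4)
  proof (induction m)
    case 0
    show ?case by (rule exI[of _ "{}"]) simp
  next
    case (Suc m)
    then obtain S where S: "S \<subseteq> A" "card S = m" "\<And>u v. (u, v) \<in> r \<Longrightarrow> v \<in> S \<Longrightarrow> u \<in> S"
      by auto
    obtain w where w: "w \<in> A - S" "\<And>u. (u, w) \<in> r \<Longrightarrow> u \<in> S"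
      using next_vertex[of S] S Suc.prems by auto
    have "card (insert w S) = Suc m"
      using S w assms(1) finite_subset by (metis DiffD2 card_insert_disjoint)
    moreover have "insert w S \<subseteq> A" using S w by blast
    moreover have "\<forall>u v. (u, v) \<in> r \<longrightarrow> v \<in> insert w S \<longrightarrow> u \<in> insert w S"
      using S(3) w(2) by blast
    ultimately show ?case by blast
  qed
  then obtain S where S: "S \<subseteq> A" "card S = m" "\<And>u v. (u, v) \<in> r \<Longrightarrow> v \<in> S \<Longrightarrow> u \<in> S"
    by blast
  moreover obtain w where "w \<in> A - S" "\<And>u. (u, w) \<in> r \<Longrightarrow> u \<in> S"
    using next_vertex[of S] S assms(4) by auto
  ultimately show thesis using that by blast
qed

section \<open>Assigning distinct prey to the lines\<close>

theorem theorem3p4: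
  fixes n :: nat
  assumes "n \<ge> 3"
  shows "competition_number (hamming_graph n 3) \<ge> (n - 3) * 3 ^ (n - 1) + 6"
proof -
  define G where "G = hamming_graph n 3"
  define k where "k = competition_number G"
  define V where "V = {1..n} \<rightarrow>\<^sub>E {1..3::nat}"
  have "\<exists>D. acyclic_digraph D \<and> competition_graph D = add_isolated G k"
    unfolding k_def competition_number_def
    by (rule LeastI_ex) (use competition_number_exists pair_graph_hamming_graph G_def in blast)
  then obtain D where D: "acyclic_digraph D" and cD: "competition_graph D = add_isolated G k"
    by blast
  interpret D: pair_fin_digraph D using D by (simp add: acyclic_digraph_def)
  have acyc: "acyclic (parcs D)" using D by (simp add: acyclic_digraph_iff)
  have sub: "parcs D \<subseteq> pverts D \<times> pverts D"
    using D.in_arcsD1 D.in_arcsD2 by auto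
  have pG: "pverts G = V" by (simp add: G_def V_def hamming_graph_def Let_def)
  have finV: "finite V" by (simp add: V_def finite_PiE)
  have vD: "pverts D = V <+> {..<k}"
    using arg_cong[OF cD, of pverts] by (simp add: competition_graph_def add_isolated_def pG)
  have "card V = 3 ^ n" by (simp add: V_def card_PiE)
  then have cardD: "card (pverts D) = 3 ^ n + k"
    by (simp add: vD card_Plus finV)
  have prey_ex: "\<exists>p\<in>pverts D. (Inl u, p) \<in> parcs D \<and> (Inl v, p) \<in> parcs D"
    if "(u, v) \<in> parcs G" for u v
  proof -
    have "(Inl u, Inl v) \<in> parcs (competition_graph D)"
      using that by (simp add: cD add_isolated_def)
    then show ?thesis by (simp add: competition_graph_def)
  qed
  have clique: "u = v \<or> (u, v) \<in> parcs G"
    if "(Inl u, p) \<in> parcs D" "(Inl v, p) \<in> parcs D" for u v p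
  proof (cases "u = v")
    case False
    then have "(Inl u, Inl v) \<in> parcs (competition_graph D)"
      using that sub by (auto simp: competition_graph_def)
    then show ?thesis by (simp add: cD add_isolated_def)
  qed simp
  \<comment> \<open>This guarantees a thirteenth vertex in \<open>D\<close>, and later that
    subtracting 13 does not truncate at 0.\<close>
  have "(27::nat) \<le> 3 ^ n"
    using power_increasing[OF assms, of "3::nat"] by simp
  then have "12 < card (pverts D)" using cardD by simp
  then obtain S w where S: "S \<subseteq> pverts D" "card S = 12" "w \<in> pverts D - S"
    "\<And>u v. (u, v) \<in> parcs D \<Longrightarrow> v \<in> insert w S \<Longrightarrow> u \<in> S"
    using ex_initial_segment[OF _ sub acyc] D.pair_finite_verts by metis
  define T where "T = insert w S"
  define S' where "S' = {x \<in> V. Inl x \<in> S}"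
  define L where "L = lines_in n V"
  \<comment> \<open>The vertex \<open>p\<close> realises some edge of the line
    \<open>(i, x)\<close>. Two of the three points suffice, since they already determine the
    line.\<close>
  define hits where "hits p i x \<longleftrightarrow> p \<in> pverts D \<and>
    (\<exists>a\<in>{1..3}. \<exists>b\<in>{1..3}. a \<noteq> b \<and> (Inl (x(i := a)), p) \<in> parcs D \<and> (Inl (x(i := b)), p) \<in> parcs D)"
    for p i x
  have adj: "(x(i := a), x(i := b)) \<in> parcs G"
    if "(i, x) \<in> L" "a \<in> {1..3}" "b \<in> {1..3}" "a \<noteq> b" for i x a b
  proof -
    have mem: "x(i := a) \<in> V" "x(i := b) \<in> V" and i: "i \<in> {1..n}"
      using that by (simp_all add: L_def lines_in_def)
    have "\<exists>!m. m \<in> {1..n} \<and> (x(i := a)) m \<noteq> (x(i := b)) m"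
      by (rule ex1I[of _ i]) (use i that(4) in \<open>simp_all split: if_splits\<close>)
    then show ?thesis
      using mem unfolding G_def V_def hamming_graph_def Let_def
      by (simp only: pair_pre_digraph.simps mem_Collect_eq case_prod_conv simp_thms)
  qed
  \<comment> \<open>Take a prey \<open>p\<close> for the edge between points 1 and 2, and
    \<open>r\<close> for the edge between points 1 and 3. If one of them is outside
    \<open>T\<close>, choose it; if both are in \<open>T\<close>, all three points are predecessors
    of vertices in \<open>T\<close> and so belong to \<open>S\<close>.\<close>
  have "\<exists>p. hits p i x \<and> (p \<in> T \<longrightarrow> (i, x) \<in> lines_in n S')" if l: "(i, x) \<in> L" for i x
  proof -
    obtain p where p: "p \<in> pverts D" "(Inl (x(i := 1)), p) \<in> parcs D" "(Inl (x(i := 2)), p) \<in> parcs D"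
      using prey_ex[OF adj[OF l, of 1 2]] by auto
    obtain r where r: "r \<in> pverts D" "(Inl (x(i := 1)), r) \<in> parcs D" "(Inl (x(i := 3)), r) \<in> parcs D"
      using prey_ex[OF adj[OF l, of 1 3]] by auto
    have hp: "hits p i x" unfolding hits_def
      using p by (intro conjI bexI[of _ 1] bexI[of _ 2]) auto
    have hr: "hits r i x" unfolding hits_def
      using r by (intro conjI bexI[of _ 1] bexI[of _ 3]) auto
    have "(i, x) \<in> lines_in n S'" if "p \<in> T" "r \<in> T"
    proof -
      have "Inl (x(i := 1)) \<in> S" "Inl (x(i := 2)) \<in> S" "Inl (x(i := 3)) \<in> S"
        using p r S(4) that unfolding T_def by blast+
      moreover have "a \<in> {1, 2, 3}" if "a \<in> {1..3}" for a :: nat using that by auto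
      ultimately have "Inl (x(i := a)) \<in> S" if "a \<in> {1..3}" for a using that by blast
      then show ?thesis using l by (simp add: L_def lines_in_def S'_def)
    qed
    then show ?thesis using hp hr by blast
  qed
  then have "\<forall>l\<in>L. \<exists>p. hits p (fst l) (snd l) \<and> (p \<in> T \<longrightarrow> l \<in> lines_in n S')"
    by (metis prod.collapse)
  then obtain f where f: "\<And>l. l \<in> L \<Longrightarrow> hits (f l) (fst l) (snd l)"
    "\<And>l. l \<in> L \<Longrightarrow> f l \<in> T \<Longrightarrow> l \<in> lines_in n S'"
    by metis
  \<comment> \<open>The predators of \<open>p\<close> form a clique containing an edge of the first
    line, so they all lie on that line. Two of them also lie on the second line, hence the lines
    coincide.\<close>
  have hits_unique: "(i, x) = (j, y)"
    if l: "(i, x) \<in> L" "(j, y) \<in> L" and h: "hits p i x" "hits p j y" for i x j y p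
  proof -
    obtain a b where ab: "a \<in> {1..3}" "b \<in> {1..3}" "a \<noteq> b"
      "(Inl (x(i := a)), p) \<in> parcs D" "(Inl (x(i := b)), p) \<in> parcs D"
      using h(1) unfolding hits_def by blast
    obtain c d where cd: "c \<noteq> d"
      "(Inl (y(j := c)), p) \<in> parcs D" "(Inl (y(j := d)), p) \<in> parcs D"
      using h(2) unfolding hits_def by blast
    have on_line: "z m = x m" if "(Inl z, p) \<in> parcs D" "m \<noteq> i" for z m
    proof -
      have "z m = (x(i := a)) m"
      proof (rule hamming_clique_direction[where n = n and q = 3 and u = "x(i := a)"
          and v = "x(i := b)" and w = z and i = i and j = m])
        show "(x(i := a), x(i := b)) \<in> parcs (hamming_graph n 3)"
          using adj[OF l(1) ab(1-3)] by (simp add: G_def)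
        show "z = x(i := a) \<or> (x(i := a), z) \<in> parcs (hamming_graph n 3)"
          using clique[OF ab(4) that(1)] by (auto simp: G_def)
        show "z = x(i := b) \<or> (x(i := b), z) \<in> parcs (hamming_graph n 3)"
          using clique[OF ab(5) that(1)] by (auto simp: G_def)
      qed (use ab(3) that(2) in auto)
      then show ?thesis using that(2) by simp
    qed
    \<comment> \<open>The two points of the second line differ at \<open>j\<close>, but points on
      the first line can differ only at \<open>i\<close>.\<close>
    have ij: "i = j"
      using on_line[OF cd(2), of j] on_line[OF cd(3), of j] cd(1) by fastforce
    \<comment> \<open>At \<open>m = i\<close> both base points have the value 1, by the encoding of
      lines.\<close>
    have "x m = y m" for m
      using on_line[OF cd(2), of m] l ij by (cases "m = i") (auto simp: L_def lines_in_def)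
    then show ?thesis using ij by auto
  qed
  have inj: "inj_on f L"
  proof (rule inj_onI)
    fix l l' assume "l \<in> L" "l' \<in> L" "f l = f l'"
    then show "l = l'"
      using hits_unique[of "fst l" "snd l" "fst l'" "snd l'" "f l"] f(1)[of l] f(1)[of l'] by simp
  qed
  have finS: "finite S" using S(2) by (metis card.infinite zero_neq_numeral)
  have cardS': "card S' \<le> 12"
    using card_inj_on_le[of Inl S' S] finS S(2) by (auto simp: S'_def)
  have "S' \<subseteq> {1..n} \<rightarrow>\<^sub>E {1..3}" by (auto simp: S'_def V_def)
  then have seven: "card (lines_in n S') \<le> 7"
    using card_lines_in_le_line_bound[of S' n] line_bound_le cardS' order_trans by blast
  have "finite (lines_in n S')" using finV by (simp add: finite_lines_in S'_def)
  \<comment> \<open>Only lines inside \<open>S'\<close> can be assigned prey in \<open>T\<close>,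
    and there are at most seven of them. So the 13 vertices of \<open>T\<close> account for at most
    7 lines, which yields the surplus 6.\<close>
  have "f ` L \<subseteq> (pverts D - T) \<union> f ` lines_in n S'"
    using f by (force simp: hits_def)
  then have "card (f ` L) \<le> card ((pverts D - T) \<union> f ` lines_in n S')"
    by (rule card_mono[rotated]) (use \<open>finite (lines_in n S')\<close> D.pair_finite_verts in simp)
  also have "\<dots> \<le> card (pverts D - T) + card (f ` lines_in n S')" by (rule card_Un_le)
  also have "\<dots> \<le> card (pverts D - T) + 7"
    using seven card_image_le[OF \<open>finite (lines_in n S')\<close>, of f] by linarith
  also have "card (pverts D - T) = card (pverts D) - 13"
    using S finS by (subst card_Diff_subset) (auto simp: T_def)
  finally have "n * 3 ^ (n - 1) \<le> (3 ^ n + k - 13) + 7"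
    unfolding card_image[OF inj] cardD unfolding L_def V_def card_lines_in_cube .
  then have "n * 3 ^ (n - 1) + 6 \<le> 3 ^ n + k"
    using \<open>27 \<le> 3 ^ n\<close> by simp
  moreover have "(3::nat) ^ n = 3 * 3 ^ (n - 1)"
    using assms by (simp add: power_eq_if)
  \<comment> \<open>Since \<open>n\<close> is at least 3, the natural subtraction
    \<open>n - 3\<close> is exact, and the \<open>3 ^ n\<close> original vertices cancel three of
    the \<open>n\<close> copies of \<open>3 ^ (n - 1)\<close>.\<close>
  moreover have "n * 3 ^ (n - 1) = (n - 3) * 3 ^ (n - 1) + 3 * 3 ^ (n - 1)"
    using assms by (metis add_mult_distrib le_add_diff_inverse2)
  ultimately show ?thesis by (simp add: k_def G_def)
qed

end
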